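(* Let $H$ and $K$ be monoids, and let $f$ be a global isomorphism from $H$ to $K$, i.e., a semigroup isomorphism $f \colon \mathcal P(H) \to \mathcal P(K)$. Then: (i) $f(H^\times) = K^\times$ (here $H^\times$ is regarded as an element of $\mathcal P(H)$ and $K^\times$ as an element of $\mathcal P(K)$); (ii) $f$ restricts to a global isomorphism from $H^\times$ to $K^\times$, i.e., $f$ restricts to a semigroup isomorphism $\mathcal P(H^\times) \to \mathcal P(K^\times)$.
   Context: For a semigroup $S$ (written multiplicatively), $\mathcal P(S)$ denotes the semigroup of all non-empty subsets of $S$ under setwise multiplication $XY := \{xy : x \in X, y \in Y\}$. A global isomorphism from a semigroup $H$ to a semigroup $K$ is a semigroup isomorphism $\mathcal P(H) \to \mathcal P(K)$. For a monoid $M$ with identity $1_M$, $M^\times$ denotes the group of units of $M$, i.e., the set of all $u \in M$ such that $uv = vu = 1_M$ for some $v \in M$; $\mathcal P(M^\times)$ is a subsemigroup of $\mathcal P(M)$. *)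

theory Defs
  imports "HOL-Algebra.Coset"
begin

text \<open>
  This structure is meant only as a semigroup. The record type demands a \<open>one\<close> field, but
  \<^const>\<open>iso\<close> ignores it, so a global isomorphism is not assumed to preserve it.
\<close>

definition power_semigroup :: "('a, 'c) monoid_scheme \<Rightarrow> 'a set monoid" where
  "power_semigroup S =
     \<lparr> carrier = {X. X \<subseteq> carrier S \<and> X \<noteq> {}},
       monoid.mult = (\<lambda>X Y. X <#>\<^bsub>S\<^esub> Y),
       one = {\<one>\<^bsub>S\<^esub>} \<rparr>"

definition global_iso ::
    "('a, 'c) monoid_scheme \<Rightarrow> ('b, 'd) monoid_scheme \<Rightarrow> ('a set \<Rightarrow> 'b set) set" where
  "global_iso H K = iso (power_semigroup H) (power_semigroup K)"

end

theory Submission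
  imports Defs
begin

text \<open>
  The units of \<open>\<P>(H)\<close> are the singletons \<open>{u}\<close> with \<open>u \<in> H\<^sup>\<times>\<close>, so \<open>f\<close> matches these with the
  singletons of units of \<open>K\<close>. Consequently \<open>{v} f(H\<^sup>\<times>) = f(H\<^sup>\<times>)\<close> for every \<open>v \<in> K\<^sup>\<times>\<close>, whence
  \<open>K\<^sup>\<times> f(H\<^sup>\<times>) = f(H\<^sup>\<times>)\<close>, that is, \<open>W H\<^sup>\<times> = H\<^sup>\<times>\<close> with \<open>W = f\<^sup>-\<^sup>1(K\<^sup>\<times>)\<close>. This forces
  \<open>W \<subseteq> H\<^sup>\<times>\<close>; and since \<open>{u} W = W\<close> for every unit \<open>u\<close>, in fact \<open>W = H\<^sup>\<times>\<close>. Finally, the non-empty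
  subsets of \<open>H\<^sup>\<times>\<close> are characterized by the equation \<open>X H\<^sup>\<times> = H\<^sup>\<times>\<close>, which \<open>f\<close> preserves.
\<close>

lemma carrier_power_semigroup:
  "X \<in> carrier (power_semigroup S) \<longleftrightarrow> X \<subseteq> carrier S \<and> X \<noteq> {}"
  by (simp add: power_semigroup_def)

lemma mult_power_semigroup: "X \<otimes>\<^bsub>power_semigroup S\<^esub> Y = X <#>\<^bsub>S\<^esub> Y"
  by (simp add: power_semigroup_def)

lemma one_power_semigroup: "\<one>\<^bsub>power_semigroup S\<^esub> = {\<one>\<^bsub>S\<^esub>}"
  by (simp add: power_semigroup_def)

lemma set_mult_units_of: "X <#>\<^bsub>units_of S\<^esub> Y = X <#>\<^bsub>S\<^esub> Y"
  by (simp add: set_mult_def units_of_def)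

lemma (in monoid) monoid_power_semigroup: "monoid (power_semigroup G)"
proof (rule monoidI)
  fix X Y Z
  assume "X \<in> carrier (power_semigroup G)" "Y \<in> carrier (power_semigroup G)"
    "Z \<in> carrier (power_semigroup G)"
  then have sub: "X \<subseteq> carrier G" "Y \<subseteq> carrier G" "Z \<subseteq> carrier G"
    and ne: "X \<noteq> {}" "Y \<noteq> {}"
    by (auto simp: carrier_power_semigroup)
  show "X \<otimes>\<^bsub>power_semigroup G\<^esub> Y \<in> carrier (power_semigroup G)"
    using sub ne by (fastforce simp: carrier_power_semigroup mult_power_semigroup set_mult_def)
  \<comment> \<open>Flattening both bracketings to a triple union lets associativity of the base
    monoid act elementwise.\<close>
  have "X <#> Y <#> Z = (\<Union>x\<in>X. \<Union>y\<in>Y. \<Union>z\<in>Z. {x \<otimes> y \<otimes> z})"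
    unfolding set_mult_def by blast
  also have "\<dots> = (\<Union>x\<in>X. \<Union>y\<in>Y. \<Union>z\<in>Z. {x \<otimes> (y \<otimes> z)})"
    using sub by (intro SUP_cong refl) (auto simp: m_assoc subset_iff)
  also have "\<dots> = X <#> (Y <#> Z)"
    unfolding set_mult_def by blast
  finally show "X \<otimes>\<^bsub>power_semigroup G\<^esub> Y \<otimes>\<^bsub>power_semigroup G\<^esub> Z =
      X \<otimes>\<^bsub>power_semigroup G\<^esub> (Y \<otimes>\<^bsub>power_semigroup G\<^esub> Z)"
    by (simp add: mult_power_semigroup)
qed (auto simp: carrier_power_semigroup mult_power_semigroup one_power_semigroup set_mult_def
    subset_iff)

text \<open>If \<open>X\<close> and \<open>Y\<close> are mutually inverse, every element of
  \<open>X\<close> is a two-sided inverse of every element of \<open>Y\<close>. Uniqueness of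
  inverses then leaves room for only one element in \<open>X\<close>.\<close>

lemma (in monoid) Units_power_semigroup: "Units (power_semigroup G) = (\<lambda>u. {u}) ` Units G"
proof (intro equalityI subsetI)
  fix X assume "X \<in> Units (power_semigroup G)"
  then obtain Y where "X \<in> carrier (power_semigroup G)" "Y \<in> carrier (power_semigroup G)"
    "Y \<otimes>\<^bsub>power_semigroup G\<^esub> X = \<one>\<^bsub>power_semigroup G\<^esub>"
    "X \<otimes>\<^bsub>power_semigroup G\<^esub> Y = \<one>\<^bsub>power_semigroup G\<^esub>"
    unfolding Units_def by blast
  then have X: "X \<subseteq> carrier G" "X \<noteq> {}" and Y: "Y \<subseteq> carrier G" "Y \<noteq> {}"
    and YX: "Y <#> X = {\<one>}" and XY: "X <#> Y = {\<one>}"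
    by (simp_all add: carrier_power_semigroup mult_power_semigroup one_power_semigroup)
  have inverse: "x \<otimes> y = \<one>" "y \<otimes> x = \<one>" if "x \<in> X" "y \<in> Y" for x y
  proof -
    have "x \<otimes> y \<in> X <#> Y" "y \<otimes> x \<in> Y <#> X"
      using that unfolding set_mult_def by blast+
    then show "x \<otimes> y = \<one>" "y \<otimes> x = \<one>"
      using XY YX by simp_all
  qed
  obtain x y where xy: "x \<in> X" "y \<in> Y"
    using X Y by blast
  \<comment> \<open>Here \<open>x'\<close> is a left inverse and \<open>x\<close> a right inverse of
    the same \<open>y\<close>.\<close>
  have "x' = x" if "x' \<in> X" for x'
    using inverse(2)[OF xy] inverse(1)[OF that xy(2)] xy that X Y
    by (intro inv_unique[of x' y x]) auto
  then have "X = {x}"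
    using xy by blast
  moreover have "x \<in> Units G"
    using inverse[OF xy] xy X Y unfolding Units_def by blast
  ultimately show "X \<in> (\<lambda>u. {u}) ` Units G"
    by blast
next
  fix X assume "X \<in> (\<lambda>u. {u}) ` Units G"
  then obtain u where u: "u \<in> Units G" and X: "X = {u}"
    by blast
  have "X \<in> carrier (power_semigroup G)" "{inv u} \<in> carrier (power_semigroup G)"
    using u X by (simp_all add: carrier_power_semigroup Units_closed)
  moreover have "{inv u} \<otimes>\<^bsub>power_semigroup G\<^esub> X = \<one>\<^bsub>power_semigroup G\<^esub>"
    "X \<otimes>\<^bsub>power_semigroup G\<^esub> {inv u} = \<one>\<^bsub>power_semigroup G\<^esub>"
    using u X by (simp_all add: mult_power_semigroup one_power_semigroup set_mult_def)
  ultimately show "X \<in> Units (power_semigroup G)"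
    unfolding Units_def by blast
qed

text \<open>Allows facts about isomorphisms to be used in the reverse direction, so that units of
  \<open>K\<close> can be pulled back to units of \<open>H\<close>.\<close>

lemma (in monoid) inv_into_iso:
  assumes "h \<in> iso G H"
  shows "inv_into (carrier G) h \<in> iso H G"
proof -
  have h: "h \<in> hom G H" "bij_betw h (carrier G) (carrier H)"
    using assms by (auto simp: iso_def)
  let ?g = "inv_into (carrier G) h"
  have bij: "bij_betw ?g (carrier H) (carrier G)"
    using h(2) by (rule bij_betw_inv_into)
  have "?g (x \<otimes>\<^bsub>H\<^esub> y) = ?g x \<otimes> ?g y" if "x \<in> carrier H" "y \<in> carrier H" for x y
  proof -
    have g: "?g x \<in> carrier G" "?g y \<in> carrier G"
      using bij that by (auto dest: bij_betwE)
    then have "h (?g x \<otimes> ?g y) = x \<otimes>\<^bsub>H\<^esub> y"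
      using h that by (simp add: hom_mult bij_betw_inv_into_right)
    then show ?thesis
      using bij_betw_inv_into_left[OF h(2)] g by (metis m_closed)
  qed
  then have "?g \<in> hom H G"
    using bij by (intro homI) (auto dest: bij_betwE)
  then show ?thesis
    using bij by (simp add: iso_def)
qed

lemma iso_Units:
  assumes "monoid G" "monoid H" "h \<in> iso G H" "u \<in> Units G"
  shows "h u \<in> Units H"
proof -
  interpret G: monoid G by fact
  interpret H: monoid H by fact
  have closed: "\<And>x. x \<in> carrier G \<Longrightarrow> h x \<in> carrier H"
    and mult: "\<And>x y. x \<in> carrier G \<Longrightarrow> y \<in> carrier G \<Longrightarrow> h (x \<otimes>\<^bsub>G\<^esub> y) = h x \<otimes>\<^bsub>H\<^esub> h y"
    and surj: "h ` carrier G = carrier H"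
    using assms(3) by (auto simp: iso_def hom_def bij_betw_def)
  \<comment> \<open>Membership in \<open>iso\<close> says nothing about identities. A preimage
    \<open>e\<close> of the identity repairs this: h(1) = h(1) h(e) = h(1 e) = h(e) = 1.\<close>
  obtain e where e: "e \<in> carrier G" "h e = \<one>\<^bsub>H\<^esub>"
    using surj H.one_closed by (metis imageE)
  have one: "h \<one>\<^bsub>G\<^esub> = \<one>\<^bsub>H\<^esub>"
    using mult[of "\<one>\<^bsub>G\<^esub>" e] e closed by simp
  have "h (inv\<^bsub>G\<^esub> u) \<otimes>\<^bsub>H\<^esub> h u = \<one>\<^bsub>H\<^esub>" "h u \<otimes>\<^bsub>H\<^esub> h (inv\<^bsub>G\<^esub> u) = \<one>\<^bsub>H\<^esub>"
    using assms(4) one by (simp_all add: mult[symmetric] G.Units_closed)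
  then show ?thesis
    using assms(4) closed G.Units_closed G.Units_inv_closed unfolding Units_def[of H] by blast
qed

lemma global_iso_singleton_unit:
  assumes "monoid H" "monoid K" "f \<in> global_iso H K" "u \<in> Units H"
  obtains v where "v \<in> Units K" "f {u} = {v}"
proof -
  have "{u} \<in> Units (power_semigroup H)"
    using assms(4) by (simp add: monoid.Units_power_semigroup[OF assms(1)])
  then have "f {u} \<in> Units (power_semigroup K)"
    using iso_Units[OF monoid.monoid_power_semigroup[OF assms(1)]
        monoid.monoid_power_semigroup[OF assms(2)]] assms(3)
    unfolding global_iso_def by blast
  then show ?thesis
    using that by (auto simp: monoid.Units_power_semigroup[OF assms(2)])
qed

lemma (in monoid) singleton_mult_Units:
  assumes "u \<in> Units G"
  shows "{u} <#> Units G = Units G"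
proof
  show "{u} <#> Units G \<subseteq> Units G"
    using assms by (auto simp: set_mult_def)
  show "Units G \<subseteq> {u} <#> Units G"
  proof
    fix x assume x: "x \<in> Units G"
    then have "x = u \<otimes> (inv u \<otimes> x)"
      using assms by (simp add: m_assoc[symmetric] Units_closed)
    moreover have "inv u \<otimes> x \<in> Units G"
      using assms x by simp
    ultimately show "x \<in> {u} <#> Units G"
      unfolding set_mult_def by blast
  qed
qed

text \<open>Since \<open>\<one>\<close> is a unit, each x = x 1 lies in the product. Conversely, the
  product is a union of translates, each equal to \<open>Units G\<close>; this union is not empty
  because \<open>X\<close> is not.\<close>

lemma (in monoid) set_mult_Units_eq_iff:
  assumes "X \<in> carrier (power_semigroup G)"
  shows "X <#> Units G = Units G \<longleftrightarrow> X \<subseteq> Units G"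
proof
  assume eq: "X <#> Units G = Units G"
  show "X \<subseteq> Units G"
  proof
    fix x assume "x \<in> X"
    then have "x \<otimes> \<one> \<in> Units G" "x \<in> carrier G"
      using eq assms unfolding set_mult_def carrier_power_semigroup by blast+
    then show "x \<in> Units G" by simp
  qed
next
  assume sub: "X \<subseteq> Units G"
  have "X <#> Units G = (\<Union>u\<in>X. {u} <#> Units G)"
    unfolding set_mult_def by blast
  also have "\<dots> = (\<Union>u\<in>X. Units G)"
    using sub singleton_mult_Units by blast
  finally show "X <#> Units G = Units G"
    using assms by (auto simp: carrier_power_semigroup)
qed

lemma global_iso_Units:
  assumes "monoid H" "monoid K" "f \<in> global_iso H K"
  shows "f (Units H) = Units K"
proof -
  interpret H: monoid H by fact
  interpret K: monoid K by fact
  define PH where "PH = carrier (power_semigroup H)"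
  define PK where "PK = carrier (power_semigroup K)"
  have inj: "inj_on f PH" and surj: "f ` PH = PK"
    and mult: "\<And>X Y. X \<in> PH \<Longrightarrow> Y \<in> PH \<Longrightarrow> f (X <#>\<^bsub>H\<^esub> Y) = f X <#>\<^bsub>K\<^esub> f Y"
    using assms(3)
    by (auto simp: global_iso_def iso_def hom_def bij_betw_def mult_power_semigroup PH_def PK_def)
  have closed: "X <#>\<^bsub>H\<^esub> Y \<in> PH" if "X \<in> PH" "Y \<in> PH" for X Y
    using monoid.m_closed[OF H.monoid_power_semigroup] that
    by (simp add: PH_def mult_power_semigroup)
  have Units_PH: "Units H \<in> PH" and Units_PK: "Units K \<in> PK"
    by (auto simp: PH_def PK_def carrier_power_semigroup)
  have singleton_PH: "{u} \<in> PH" if "u \<in> Units H" for u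
    using that by (simp add: PH_def carrier_power_semigroup H.Units_closed)
  have inv_iso: "inv_into PH f \<in> global_iso K H"
    unfolding global_iso_def PH_def
    using H.monoid_power_semigroup assms(3)
    by (intro monoid.inv_into_iso) (simp_all add: global_iso_def)
  have absorb: "{v} <#>\<^bsub>K\<^esub> f (Units H) = f (Units H)" if v: "v \<in> Units K" for v
  proof -
    \<comment> \<open>Pulling \<open>v\<close> back along the inverse isomorphism gives {v} f(U) =
      f({u} U) = f(U), where U is \<open>Units H\<close>.\<close>
    obtain u where u: "u \<in> Units H" "inv_into PH f {v} = {u}"
      using global_iso_singleton_unit[OF assms(2,1) inv_iso v] .
    have "{v} \<in> PK"
      using v by (simp add: PK_def carrier_power_semigroup K.Units_closed)
    then have "f {u} = {v}"
      using u f_inv_into_f surj by metis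
    then show ?thesis
      using mult[OF singleton_PH Units_PH] H.singleton_mult_Units u(1) by metis
  qed
  have "Units K <#>\<^bsub>K\<^esub> f (Units H) = (\<Union>v\<in>Units K. {v} <#>\<^bsub>K\<^esub> f (Units H))"
    unfolding set_mult_def by blast
  also have "\<dots> = (\<Union>v\<in>Units K. f (Units H))"
    using absorb by blast
  also have "\<dots> = f (Units H)"
    using K.Units_one_closed by blast
  finally have Units_absorb: "Units K <#>\<^bsub>K\<^esub> f (Units H) = f (Units H)" .
  obtain W where W: "W \<in> PH" "f W = Units K"
    using surj Units_PK by (metis imageE)
  \<comment> \<open>Both sides have the same image under the injective \<open>f\<close>, by
    \<open>Units_absorb\<close>.\<close>
  have "W <#>\<^bsub>H\<^esub> Units H = Units H"
    using Units_absorb mult[OF W(1) Units_PH] W inj_onD[OF inj] closed Units_PH by metis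
  then have W_sub: "W \<subseteq> Units H"
    using H.set_mult_Units_eq_iff W(1) by (simp add: PH_def)
  have W_invariant: "{u} <#>\<^bsub>H\<^esub> W = W" if u: "u \<in> Units H" for u
  proof -
    obtain v where "v \<in> Units K" "f {u} = {v}"
      using global_iso_singleton_unit[OF assms u] .
    \<comment> \<open>The image of {u} W is {v} times \<open>Units K\<close>, which is
      \<open>Units K\<close> again, that is, \<open>f W\<close>.\<close>
    then have "f ({u} <#>\<^bsub>H\<^esub> W) = f W"
      using mult[OF singleton_PH[OF u] W(1)] W(2) K.singleton_mult_Units by simp
    then show ?thesis
      using inj_onD[OF inj] closed singleton_PH u W(1) by blast
  qed
  obtain w where w: "w \<in> W"
    using W(1) by (auto simp: PH_def carrier_power_semigroup)
  have "Units H \<subseteq> W"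
  proof
    fix u assume u: "u \<in> Units H"
    have wU: "w \<in> Units H"
      using w W_sub by blast
    \<comment> \<open>The fixed \<open>w\<close> is invertible because \<open>W\<close> consists of
      units, so a translation by a unit carries it to any prescribed unit \<open>u\<close>.\<close>
    have "(u \<otimes>\<^bsub>H\<^esub> inv\<^bsub>H\<^esub> w) \<otimes>\<^bsub>H\<^esub> w \<in> W"
      using W_invariant[of "u \<otimes>\<^bsub>H\<^esub> inv\<^bsub>H\<^esub> w"] u w wU by (auto simp: set_mult_def)
    then show "u \<in> W"
      using u wU by (simp add: H.m_assoc H.Units_closed)
  qed
  then show ?thesis
    using W W_sub by auto
qed

theorem theorem2p3:
  fixes H :: "('a, 'c) monoid_scheme" and K :: "('b, 'd) monoid_scheme"
    and f :: "'a set \<Rightarrow> 'b set"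
  assumes "monoid H" and "monoid K"
    and "f \<in> global_iso H K"
  shows "f (Units H) = Units K \<and> f \<in> global_iso (units_of H) (units_of K)"
proof
  interpret H: monoid H by fact
  interpret K: monoid K by fact
  show Units_eq: "f (Units H) = Units K"
    using assms by (rule global_iso_Units)
  define PH where "PH = carrier (power_semigroup H)"
  define PK where "PK = carrier (power_semigroup K)"
  define UH where "UH = carrier (power_semigroup (units_of H))"
  define UK where "UK = carrier (power_semigroup (units_of K))"
  have inj: "inj_on f PH" and surj: "f ` PH = PK"
    and mult: "\<And>X Y. X \<in> PH \<Longrightarrow> Y \<in> PH \<Longrightarrow> f (X <#>\<^bsub>H\<^esub> Y) = f X <#>\<^bsub>K\<^esub> f Y"
    using assms(3)
    by (auto simp: global_iso_def iso_def hom_def bij_betw_def mult_power_semigroup PH_def PK_def)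
  have closed: "X <#>\<^bsub>H\<^esub> Y \<in> PH" if "X \<in> PH" "Y \<in> PH" for X Y
    using monoid.m_closed[OF H.monoid_power_semigroup] that
    by (simp add: PH_def mult_power_semigroup)
  have Units_PH: "Units H \<in> PH"
    by (auto simp: PH_def carrier_power_semigroup)
  \<comment> \<open>Membership becomes an equation between products in the ambient power semigroup,
    a form that \<open>f\<close> can transport.\<close>
  have UH_iff: "X \<in> UH \<longleftrightarrow> X \<in> PH \<and> X <#>\<^bsub>H\<^esub> Units H = Units H" for X
    using H.set_mult_Units_eq_iff[of X] H.Units_closed
    by (auto simp: UH_def PH_def carrier_power_semigroup units_of_carrier)
  have UK_iff: "X \<in> UK \<longleftrightarrow> X \<in> PK \<and> X <#>\<^bsub>K\<^esub> Units K = Units K" for X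
    using K.set_mult_Units_eq_iff[of X] K.Units_closed
    by (auto simp: UK_def PK_def carrier_power_semigroup units_of_carrier)
  have f_iff: "f X \<in> UK \<longleftrightarrow> X \<in> UH" if X: "X \<in> PH" for X
  proof -
    have "f X <#>\<^bsub>K\<^esub> Units K = Units K \<longleftrightarrow> f (X <#>\<^bsub>H\<^esub> Units H) = f (Units H)"
      using mult[OF X Units_PH] Units_eq by simp
    also have "\<dots> \<longleftrightarrow> X <#>\<^bsub>H\<^esub> Units H = Units H"
      using inj closed[OF X Units_PH] Units_PH by (rule inj_on_eq_iff)
    finally show ?thesis
      using X surj by (auto simp: UH_iff UK_iff)
  qed
  have UH_sub: "UH \<subseteq> PH" and UK_sub: "UK \<subseteq> PK"
    using UH_iff UK_iff by blast+
  \<comment> \<open>A member of \<open>UK\<close> has a preimage in \<open>PH\<close> by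
    surjectivity, and \<open>f_iff\<close> places that preimage in \<open>UH\<close>.\<close>
  have image: "f ` UH = UK"
    using f_iff UH_sub UK_sub surj by blast
  have "bij_betw f UH UK"
    using inj_on_subset[OF inj UH_sub] image by (simp add: bij_betw_def)
  \<comment> \<open>Products of subsets of units are the same in \<open>units_of H\<close> as in
    \<open>H\<close>, so multiplicativity is inherited; \<open>image\<close> supplies
    closure.\<close>
  moreover have "f \<in> hom (power_semigroup (units_of H)) (power_semigroup (units_of K))"
    using image mult UH_sub
    by (intro homI) (auto simp: UH_def UK_def mult_power_semigroup set_mult_units_of subset_iff)
  ultimately show "f \<in> global_iso (units_of H) (units_of K)"
    by (simp add: global_iso_def iso_def UH_def UK_def)
qed

end
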